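(* Let $Z_3(n)=\sum_{p\vdash n}\mathrm{Sym}(p)$, the sum being over all partitions of $n$. Then, as $n\to\infty$, one has the asymptotic expansion in powers of $1/n$ $$\frac{Z_3(n)}{n!}\sim 1+\sum_{l=2}^{\infty} n^{-l}\sum_{k=2}^{l}S(l-1,k-1)\sum_{\substack{q\vdash k\\ q_1=0}}\mathrm{Sym}(q),$$ that is, for every fixed integer $L\ge 0$, $$\lim_{n\to\infty}n^{L}\left(\frac{Z_3(n)}{n!}-1-\sum_{l=2}^{L} n^{-l}\sum_{k=2}^{l}S(l-1,k-1)\sum_{\substack{q\vdash k\\ q_1=0}}\mathrm{Sym}(q)\right)=0.$$
   Context: A partition $p\vdash n$ is specified by non-negative integers $(p_1,\dots,p_n)$ with $\sum_i i\,p_i=n$, where $p_i$ is the number of parts of length $i$. Its symmetry factor is $\mathrm{Sym}(p)=\prod_{i=1}^n i^{p_i}\,p_i!$. The condition $q_1=0$ means that $q$ has no part equal to $1$. $S(a,b)$ denotes the Stirling number of the second kind, with generating function $\frac{1}{(1-x)(1-2x)\cdots(1-kx)}=\sum_{r\ge0}S(k+r,k)x^r$. An empty sum is $0$. *)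

theory Defs
  imports Complex_Main "HOL-Combinatorics.Stirling"
begin

text \<open>
  A partition of \<open>n\<close> is given by its multiplicities: \<open>p i\<close> is the number of parts of length \<open>i\<close>.
  The tuple \<open>(p\<^sub>1, \<dots>, p\<^sub>n)\<close> is extended by \<open>0\<close> to a function on all of \<open>nat\<close>, so that each
  partition is represented exactly once.
\<close>

definition partitions :: "nat \<Rightarrow> (nat \<Rightarrow> nat) set" where
  "partitions n = {p. (\<forall>i. i \<notin> {1..n} \<longrightarrow> p i = 0) \<and> (\<Sum>i=1..n. i * p i) = n}"

definition Sym :: "nat \<Rightarrow> (nat \<Rightarrow> nat) \<Rightarrow> nat" where
  "Sym n p = (\<Prod>i=1..n. i ^ p i * fact (p i))"

definition Z3 :: "nat \<Rightarrow> nat" where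
  "Z3 n = (\<Sum>p\<in>partitions n. Sym n p)"

text \<open>The sums over \<open>partitions n\<close> are genuine finite sums.\<close>

lemma finite_partitions: "finite (partitions n)"
proof (rule finite_subset)
  show "partitions n \<subseteq> {p. \<forall>i. (i \<in> {1..n} \<longrightarrow> p i \<in> {..n}) \<and> (i \<notin> {1..n} \<longrightarrow> p i = 0)}"
  proof
    fix p assume p: "p \<in> partitions n"
    have "p i \<le> n" if i: "i \<in> {1..n}" for i
    proof -
      have "p i \<le> i * p i" using i by simp
      also have "i * p i \<le> (\<Sum>j=1..n. j * p j)"
        using i by (intro member_le_sum[of i "{1..n}" "\<lambda>j. j * p j"]) auto
      also have "\<dots> = n" using p by (simp add: partitions_def)
      finally show ?thesis .
    qed
    then show "p \<in> {p. \<forall>i. (i \<in> {1..n} \<longrightarrow> p i \<in> {..n}) \<and> (i \<notin> {1..n} \<longrightarrow> p i = 0)}"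
      using p by (simp add: partitions_def)
  qed
  show "finite {p. \<forall>i. (i \<in> {1..n} \<longrightarrow> p i \<in> {..n}) \<and> (i \<notin> {1..n} \<longrightarrow> p i = (0::nat))}"
    by (rule finite_set_of_finite_funs) auto
qed

end

theory Submission
  imports Defs "HOL-Library.FuncSet"
begin

text \<open>
  Split off the parts equal to \<open>1\<close>: if \<open>p\<close> has \<open>n - k\<close> of them, they contribute the factor
  \<open>(n - k)!\<close> to \<open>Sym(p)\<close>, so \<open>Z\<^sub>3(n)/n!\<close> is the sum of \<open>A\<^sub>k / (n(n-1)\<dots>(n-k+1))\<close> over \<open>k \<le> n\<close>,
  where \<open>A\<^sub>k\<close> is the sum of \<open>Sym(q)\<close> over partitions \<open>q\<close> of \<open>k\<close> without part \<open>1\<close>. For fixed \<open>k\<close>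
  the reciprocal falling factorial expands in powers of \<open>1/n\<close> with Stirling coefficients.
  Partitions without part \<open>1\<close> have at most \<open>k/2\<close> parts, whence \<open>A\<^sub>k \<le> 8\<^sup>k \<lfloor>k/2\<rfloor>!\<close>, and all terms
  with \<open>k \<ge> 2L + 4\<close> are at most \<open>(128/n)\<^sup>L\<^sup>+\<^sup>2\<close>, uniformly in \<open>k\<close>.
\<close>

section \<open>Splitting off the parts equal to 1\<close>

definition Sym_sum_no_ones :: "nat \<Rightarrow> nat" where
  "Sym_sum_no_ones k = (\<Sum>q\<in>{q \<in> partitions k. q 1 = 0}. Sym k q)"

lemma sum_atLeast1_extend:
  fixes f :: "nat \<Rightarrow> nat"
  assumes "k \<le> n" "\<And>i. i > k \<Longrightarrow> f i = 0"
  shows "(\<Sum>i=1..n. f i) = (\<Sum>i=1..k. f i)"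
  using assms by (intro sum.mono_neutral_right) auto

text \<open>A length of multiplicity 0 contributes \<open>i ^ 0 * fact 0 = 1\<close>. This allows a
  partition of \<open>k\<close> to be compared with partitions of a larger \<open>n\<close>, whose
  products run over a longer range.\<close>

lemma Sym_extend:
  assumes "k \<le> n" "\<And>i. i > k \<Longrightarrow> q i = 0"
  shows "Sym n q = Sym k q"
  unfolding Sym_def using assms by (intro prod.mono_neutral_right) auto

lemma partitions_outside:
  assumes "p \<in> partitions n" "i > n"
  shows "p i = 0"
  using assms by (auto simp: partitions_def)

lemma sum_parts_split_ones:
  assumes "n \<ge> (1::nat)"
  shows "(\<Sum>i=1..n. i * p i) = p 1 + (\<Sum>i=1..n. i * (p(1:=0)) i)"
proof -
  have "(\<Sum>i=1..n. i * p i) = p 1 + (\<Sum>i\<in>{1..n}-{1}. i * p i)"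
    using assms by (subst sum.remove[of _ 1]) auto
  moreover have "(\<Sum>i=1..n. i * (p(1:=0)) i) = (\<Sum>i\<in>{1..n}-{1}. i * p i)"
    using assms by (subst sum.remove[of _ 1]) (auto intro!: sum.cong)
  ultimately show ?thesis by simp
qed

lemma Sym_split_ones:
  assumes "n \<ge> 1"
  shows "Sym n p = fact (p 1) * Sym n (p(1:=0))"
proof -
  have "Sym n p = fact (p 1) * (\<Prod>i\<in>{1..n}-{1}. i ^ p i * fact (p i))"
    unfolding Sym_def using assms by (subst prod.remove[of _ 1]) auto
  moreover have "Sym n (p(1:=0)) = (\<Prod>i\<in>{1..n}-{1}. i ^ p i * fact (p i))"
    unfolding Sym_def using assms by (subst prod.remove[of _ 1]) (auto intro!: prod.cong)
  ultimately show ?thesis by simp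
qed

lemma remove_ones_partition:
  assumes "n \<ge> 1" "p \<in> partitions n"
  shows "p 1 \<le> n" "p(1:=0) \<in> partitions (n - p 1)"
proof -
  let ?q = "p(1:=0)"
  have s: "n = p 1 + (\<Sum>i=1..n. i * ?q i)"
    using assms sum_parts_split_ones[of n p] by (simp add: partitions_def)
  then show le: "p 1 \<le> n" by linarith
  \<comment> \<open>A single part longer than \<open>n - p 1\<close> would already exceed the total
    that the ones leave over.\<close>
  have z: "?q i = 0" if "i > n - p 1" for i
  proof (cases "i \<le> n")
    case True
    have "i * ?q i \<le> (\<Sum>i=1..n. i * ?q i)"
      using that True by (intro member_le_sum[of i "{1..n}" "\<lambda>i. i * ?q i"]) auto
    then have "i * ?q i < i" using s that by linarith
    then show ?thesis by simp
  qed (use assms partitions_outside in auto)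
  have "(\<Sum>i=1..n - p 1. i * ?q i) = (\<Sum>i=1..n. i * ?q i)"
    by (rule sum_atLeast1_extend[symmetric]) (use z in auto)
  also have "\<dots> = n - p 1" using s by linarith
  finally have e: "(\<Sum>i=1..n - p 1. i * ?q i) = n - p 1" .
  have z0: "?q 0 = 0" using assms by (auto simp: partitions_def)
  have "?q i = 0" if "i \<notin> {1..n - p 1}" for i
    using that z[of i] z0 by (cases "i = 0") auto
  with e show "?q \<in> partitions (n - p 1)" unfolding partitions_def by blast
qed

lemma add_ones_partition:
  assumes "n \<ge> 1" "k \<le> n" "q \<in> partitions k" "q 1 = 0"
  shows "q(1 := n - k) \<in> partitions n"
proof -
  let ?p = "q(1 := n - k)"
  have q: "?p(1 := 0) = q" using assms by auto
  have "(\<Sum>i=1..n. i * q i) = (\<Sum>i=1..k. i * q i)"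
    using assms partitions_outside by (intro sum_atLeast1_extend) auto
  then have "(\<Sum>i=1..n. i * q i) = k"
    using assms(3) by (simp add: partitions_def)
  then have "(\<Sum>i=1..n. i * ?p i) = n"
    using sum_parts_split_ones[OF assms(1), of ?p] assms(2) unfolding q by simp
  then show ?thesis
    using assms by (auto simp: partitions_def)
qed

text \<open>Erasing the ones of \<open>p\<close> and recording \<open>k = n - p 1\<close> is a
  bijection onto pairs of \<open>k\<close> and a partition of \<open>k\<close> without part 1; its
  inverse puts \<open>n - k\<close> ones back. The ones contribute
  \<open>1 ^ (n - k) * fact (n - k)\<close> to the weight.\<close>

lemma Z3_eq_sum_fact:
  assumes "n \<ge> 1"
  shows "Z3 n = (\<Sum>k\<le>n. fact (n - k) * Sym_sum_no_ones k)"
proof -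
  define S where "S = (SIGMA k:{..n}. {q \<in> partitions k. q 1 = 0})"
  have "(\<Sum>k\<le>n. fact (n - k) * Sym_sum_no_ones k)
      = (\<Sum>(k,q)\<in>S. fact (n - k) * Sym k q)"
    unfolding S_def Sym_sum_no_ones_def sum_distrib_left
    by (rule sum.Sigma) (auto simp: finite_partitions)
  also have "\<dots> = (\<Sum>p\<in>partitions n. Sym n p)"
  proof (rule sum.reindex_bij_witness[of _ "\<lambda>p. (n - p 1, p(1:=0))" "\<lambda>(k,q). q(1 := n - k)"])
    fix a assume "a \<in> S"
    then obtain k q where a: "a = (k, q)" "k \<le> n" "q \<in> partitions k" "q 1 = 0"
      by (auto simp: S_def)
    show "(\<lambda>p. (n - p 1, p(1 := 0))) (case a of (k, q) \<Rightarrow> q(1 := n - k)) = a"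
      using a by auto
    show "(case a of (k, q) \<Rightarrow> q(1 := n - k)) \<in> partitions n"
      using a add_ones_partition assms by simp
    have q: "(q(1 := n - k))(1 := 0) = q" using a by auto
    have "Sym n (q(1 := n - k)) = fact (n - k) * Sym n q"
      using Sym_split_ones[OF assms, of "q(1 := n - k)"] unfolding q by simp
    also have "Sym n q = Sym k q"
      using a partitions_outside by (intro Sym_extend) auto
    finally show "Sym n (case a of (k, q) \<Rightarrow> q(1 := n - k))
        = (case a of (k, q) \<Rightarrow> fact (n - k) * Sym k q)"
      unfolding a(1) prod.case .
  next
    fix p assume p: "p \<in> partitions n"
    show "(case (n - p 1, p(1 := 0)) of (k, q) \<Rightarrow> q(1 := n - k)) = p"
      using remove_ones_partition(1)[OF assms p] by auto
    show "(n - p 1, p(1 := 0)) \<in> S"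
      using remove_ones_partition(2)[OF assms p] by (auto simp: S_def)
  qed
  finally show ?thesis by (simp add: Z3_def)
qed

lemma Sym_sum_no_ones_0: "Sym_sum_no_ones 0 = 1"
proof -
  have "{q \<in> partitions 0. q 1 = 0} = {\<lambda>_. 0}"
    by (auto simp: partitions_def)
  then show ?thesis by (simp add: Sym_sum_no_ones_def Sym_def)
qed

lemma Sym_sum_no_ones_1: "Sym_sum_no_ones (Suc 0) = 0"
proof -
  have "{q \<in> partitions (Suc 0). q 1 = 0} = {}"
    by (auto simp: partitions_def)
  then show ?thesis unfolding Sym_sum_no_ones_def by (simp only: sum.empty)
qed

section \<open>Growth of the sum over partitions without part 1\<close>

lemma fact_mult_fact_le: "fact a * fact b \<le> (fact (a + b) :: nat)"
  by (rule dvd_imp_le[OF fact_fact_dvd_fact]) simp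

lemma prod_fact_le_fact_sum:
  assumes "finite A"
  shows "(\<Prod>i\<in>A. fact (f i)) \<le> (fact (\<Sum>i\<in>A. f i) :: nat)"
  using assms
proof (induction A rule: finite_induct)
  case (insert x A)
  have "(\<Prod>i\<in>insert x A. fact (f i)) = fact (f x) * (\<Prod>i\<in>A. fact (f i) :: nat)"
    using insert by simp
  also have "\<dots> \<le> fact (f x) * fact (\<Sum>i\<in>A. f i)"
    using insert by simp
  also have "\<dots> \<le> fact (f x + (\<Sum>i\<in>A. f i))" by (rule fact_mult_fact_le)
  finally show ?case using insert by simp
qed simp

text \<open>All parts have length at least 2, so there are at most \<open>k div 2\<close> of them,
  and the product of the factorials of the multiplicities is at most the factorial of their sum. The
  product of all parts is at most \<open>2 ^ k\<close> because \<open>i \<le> 2 ^ i\<close>.\<close>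

lemma Sym_no_ones_le:
  assumes "q \<in> partitions k" "q 1 = 0"
  shows "Sym k q \<le> 2 ^ k * fact (k div 2)"
proof -
  have e: "(\<Sum>i=1..k. i * q i) = k" using assms by (simp add: partitions_def)
  have "2 * (\<Sum>i=1..k. q i) = (\<Sum>i=1..k. 2 * q i)" by (rule sum_distrib_left)
  also have "\<dots> \<le> (\<Sum>i=1..k. i * q i)"
  proof (rule sum_mono)
    fix i assume "i \<in> {1..k}"
    then show "2 * q i \<le> i * q i" using assms(2) by (cases "i = 1") auto
  qed
  finally have s: "(\<Sum>i=1..k. q i) \<le> k div 2" using e by linarith
  have "(\<Prod>i=1..k. i ^ q i) \<le> (\<Prod>i=1..k. 2 ^ (i * q i))"
  proof (rule prod_mono)
    fix i :: nat
    have "i \<le> 2 ^ i" using less_exp[of i] by simp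
    then show "0 \<le> i ^ q i \<and> i ^ q i \<le> 2 ^ (i * q i)"
      by (simp add: power_mult power_mono)
  qed
  also have "\<dots> = 2 ^ k" using e by (simp add: power_sum[symmetric])
  finally have a: "(\<Prod>i=1..k. i ^ q i) \<le> 2 ^ k" .
  have "(\<Prod>i=1..k. fact (q i)) \<le> (fact (\<Sum>i=1..k. q i) :: nat)"
    by (rule prod_fact_le_fact_sum) simp
  also have "\<dots> \<le> fact (k div 2)" using s by (rule fact_mono)
  finally have b: "(\<Prod>i=1..k. fact (q i)) \<le> (fact (k div 2) :: nat)" .
  show ?thesis unfolding Sym_def prod.distrib using a b by (rule mult_le_mono)
qed

text \<open>Length \<open>i\<close> occurs at most \<open>n div i\<close> times, so independent
  choices of the multiplicities bound the count. Any exponential bound suffices, since the factorial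
  ratios in the tail supply powers of \<open>1/n\<close>.\<close>

lemma card_partitions_le: "card (partitions n) \<le> 4 ^ n"
proof -
  let ?P = "PiE {1..n} (\<lambda>i. {..n div i})"
  \<comment> \<open>Members of \<open>PiE\<close> are \<open>undefined\<close> outside
    \<open>{1..n}\<close> whereas partitions are 0 there, hence the restriction; it loses nothing
    because the values outside are fixed.\<close>
  have "inj_on (\<lambda>p. restrict p {1..n}) (partitions n)"
  proof (rule inj_onI)
    fix p p' assume p: "p \<in> partitions n" "p' \<in> partitions n"
      and e: "restrict p {1..n} = restrict p' {1..n}"
    show "p = p'"
    proof
      fix i
      show "p i = p' i"
        using p fun_cong[OF e, of i] by (cases "i \<in> {1..n}") (auto simp: partitions_def)
    qed
  qed
  moreover have "(\<lambda>p. restrict p {1..n}) ` partitions n \<subseteq> ?P"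
  proof -
    have "p i \<le> n div i" if p: "p \<in> partitions n" and i: "i \<in> {1..n}" for p i
    proof -
      have "i * p i \<le> (\<Sum>j=1..n. j * p j)"
        using i by (intro member_le_sum[of i "{1..n}" "\<lambda>j. j * p j"]) auto
      also have "\<dots> = n" using p by (simp add: partitions_def)
      finally have "p i * i \<le> n" by (simp add: mult.commute)
      then show ?thesis using i by (simp add: less_eq_div_iff_mult_less_eq)
    qed
    then show ?thesis by auto
  qed
  ultimately have "card (partitions n) \<le> card ?P"
    by (intro card_inj_on_le) (auto intro: finite_PiE)
  also have "card ?P = (\<Prod>i=1..n. Suc (n div i))" by (simp add: card_PiE)
  finally have "real (card (partitions n)) \<le> real (\<Prod>i=1..n. Suc (n div i))"
    by (rule of_nat_mono)
  also have "\<dots> = (\<Prod>i=1..n. 1 + real (n div i))" by simp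
  also have "\<dots> \<le> (\<Prod>i=1..n. real (n + i) / real i)"
  proof (rule prod_mono)
    fix i assume i: "i \<in> {1..n}"
    have "real (n div i) \<le> real n / real i" by (rule of_nat_div_le_of_nat)
    then show "0 \<le> 1 + real (n div i) \<and> 1 + real (n div i) \<le> real (n + i) / real i"
      using i by (simp add: add_divide_distrib)
  qed
  \<comment> \<open>This product is the central binomial coefficient.\<close>
  also have "\<dots> \<le> 4 ^ n"
  proof -
    have "(\<Prod>i=1..m. real (n + i) / real i) = real ((n + m) choose m)" for m
    proof (induction m)
      case (Suc m)
      have "real (Suc m) * real ((n + Suc m) choose Suc m) = real (n + Suc m) * real ((n + m) choose m)"
        using Suc_times_binomial_eq[of "n + m" m]
        by (metis add_Suc_right mult.commute of_nat_mult)
      then show ?case using Suc by (simp add: field_simps)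
    qed simp
    then have "(\<Prod>i=1..n. real (n + i) / real i) = real ((n + n) choose n)" .
    also have "\<dots> \<le> real (2 ^ (n + n))"
      by (rule of_nat_mono[OF binomial_le_pow2])
    also have "\<dots> = 4 ^ n" by (simp add: power_add power_mult_distrib[symmetric])
    finally show ?thesis .
  qed
  finally show ?thesis by (metis of_nat_le_iff of_nat_numeral of_nat_power)
qed

text \<open>The base is \<open>8 = 4 * 2\<close>: a factor 4 from counting partitions and a factor 2
  from the product of the parts.\<close>

lemma Sym_sum_no_ones_le: "Sym_sum_no_ones k \<le> 8 ^ k * fact (k div 2)"
proof -
  have "Sym_sum_no_ones k \<le> card {q \<in> partitions k. q 1 = 0} * (2 ^ k * fact (k div 2))"
    unfolding Sym_sum_no_ones_def
    using sum_bounded_above[of "{q \<in> partitions k. q 1 = 0}" "Sym k" "2 ^ k * fact (k div 2)"]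
      Sym_no_ones_le by auto
  also have "card {q \<in> partitions k. q 1 = 0} \<le> card (partitions k)"
    by (rule card_mono) (auto simp: finite_partitions)
  also have "card (partitions k) \<le> 4 ^ k" by (rule card_partitions_le)
  also have "4 ^ k * (2 ^ k * fact (k div 2)) = 8 ^ k * (fact (k div 2) :: nat)"
    by (simp add: power_mult_distrib[symmetric] mult.assoc[symmetric])
  finally show ?thesis by simp
qed

section \<open>Falling factorials and the tail of large \<open>k\<close>\<close>

lemma fact_ratio_eq:
  assumes "k \<le> n"
  shows "fact (n - k) / fact n = 1 / (\<Prod>j<k. real n - real j)"
  using assms
proof (induction k)
  case (Suc k)
  have "fact (n - k) = (real n - real k) * fact (n - Suc k)"
    using Suc.prems by (subst fact_reduce) (auto simp: of_nat_diff)
  then have "fact (n - Suc k) / fact n = (fact (n - k) / fact n) / (real n - real k)"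
    using Suc.prems by simp
  then show ?case using Suc by simp
qed simp

text \<open>Merging the two factorials leaves at most \<open>fact (n - h) / fact n\<close>, where
  \<open>h\<close> is half of \<open>k\<close> rounded up. This is a product of \<open>h\<close>
  reciprocals of \<open>n - j\<close> with \<open>j < h\<close>, and each \<open>n - j\<close> is at
  least \<open>n / 2\<close>.\<close>

lemma fact_half_ratio_le:
  assumes "k \<le> n" "n \<ge> 1"
  shows "fact (k div 2) * fact (n - k) / fact n \<le> (2 / real n) ^ (k - k div 2)"
proof -
  define h where "h = k - k div 2"
  \<comment> \<open>The \<open>+ 1\<close> covers odd \<open>k\<close>, where
    \<open>2 * h = k + 1\<close>.\<close>
  have h: "h \<le> n" "k div 2 + (n - k) = n - h" "2 * h \<le> n + 1"
    using assms by (auto simp: h_def)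
  have "fact (k div 2) * fact (n - k) \<le> (fact (n - h) :: nat)"
    using fact_mult_fact_le[of "k div 2" "n - k"] h by simp
  then have "fact (k div 2) * fact (n - k) \<le> (fact (n - h) :: real)"
    by (metis of_nat_fact of_nat_le_iff of_nat_mult)
  then have "fact (k div 2) * fact (n - k) / fact n \<le> fact (n - h) / (fact n :: real)"
    by (rule divide_right_mono) simp
  also have "\<dots> = 1 / (\<Prod>j<h. real n - real j)"
    using h by (intro fact_ratio_eq) simp
  also have "\<dots> \<le> 1 / (\<Prod>j<h. real n / 2)"
  proof (rule divide_left_mono)
    have b: "real n / 2 \<le> real n - real j" if "j < h" for j
    proof -
      have "2 * j \<le> n" using that h by linarith
      then show ?thesis by simp
    qed
    show "(\<Prod>j<h. real n / 2) \<le> (\<Prod>j<h. real n - real j)"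
      using b by (intro prod_mono) auto
    have "(\<Prod>j<h. real n / 2) > 0" using assms by (intro prod_pos) auto
    moreover have "(\<Prod>j<h. real n - real j) > 0"
    proof (rule prod_pos, clarify)
      fix j assume "j < h"
      then show "0 < real n - real j" using b[of j] assms by simp
    qed
    ultimately show "0 < (\<Prod>j<h. real n - real j) * (\<Prod>j<h. real n / 2)" by simp
  qed simp
  also have "\<dots> = (2 / real n) ^ h" by (simp add: power_divide)
  finally show ?thesis by (simp add: h_def)
qed

text \<open>From \<open>k \<le> 2 * h\<close> follows \<open>8 ^ k \<le> 64 ^ h\<close>, and
  \<open>64 * 2 = 128\<close>. For \<open>n \<ge> 128\<close> the base is at most 1, so the exponent
  may be lowered from \<open>h\<close> to \<open>M\<close>.\<close>

lemma tail_term_le: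
  assumes "2 * M \<le> k" "k \<le> n" "n \<ge> 128"
  shows "real (Sym_sum_no_ones k) * fact (n - k) / fact n \<le> (128 / real n) ^ M"
proof -
  define h where "h = k - k div 2"
  have h: "M \<le> h" "k \<le> 2 * h" using assms by (auto simp: h_def)
  have "real (Sym_sum_no_ones k) \<le> real (8 ^ k * fact (k div 2))"
    by (rule of_nat_mono[OF Sym_sum_no_ones_le])
  then have "real (Sym_sum_no_ones k) * fact (n - k) / fact n
      \<le> 8 ^ k * fact (k div 2) * fact (n - k) / fact n"
    by (intro divide_right_mono mult_right_mono) auto
  also have "\<dots> = 8 ^ k * (fact (k div 2) * fact (n - k) / fact n)" by simp
  also have "\<dots> \<le> 8 ^ k * (2 / real n) ^ h"
    unfolding h_def using assms by (intro mult_left_mono fact_half_ratio_le) auto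
  also have "\<dots> \<le> 8 ^ (2 * h) * (2 / real n) ^ h"
    using h by (intro mult_right_mono power_increasing) auto
  also have "\<dots> = (128 / real n) ^ h"
    by (simp add: power_mult power_mult_distrib[symmetric])
  also have "\<dots> \<le> (128 / real n) ^ M"
    using h assms by (intro power_decreasing) auto
  finally show ?thesis .
qed

text \<open>The range starts at \<open>2 * M\<close> for \<open>M = L + 2\<close>: of these powers
  of \<open>1/n\<close>, \<open>L\<close> cancel the prefactor, one pays for the at most
  \<open>n\<close> terms, and one is left to force the limit.\<close>

lemma tail_tendsto_0:
  "(\<lambda>n. real n ^ L * (\<Sum>k\<in>{2 * L + 4..n}. real (Sym_sum_no_ones k) * fact (n - k) / fact n))
    \<longlonglongrightarrow> 0"
proof (rule tendsto_sandwich)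
  show "(\<lambda>_. 0 :: real) \<longlonglongrightarrow> 0" by simp
  show "(\<lambda>n. 128 ^ (L + 2) / real n) \<longlonglongrightarrow> 0" by (rule lim_const_over_n)
  show "\<forall>\<^sub>F n in sequentially. 0 \<le>
      real n ^ L * (\<Sum>k\<in>{2 * L + 4..n}. real (Sym_sum_no_ones k) * fact (n - k) / fact n)"
    by (intro always_eventually allI mult_nonneg_nonneg sum_nonneg) auto
  show "\<forall>\<^sub>F n in sequentially.
      real n ^ L * (\<Sum>k\<in>{2 * L + 4..n}. real (Sym_sum_no_ones k) * fact (n - k) / fact n)
      \<le> 128 ^ (L + 2) / real n"
    using eventually_ge_at_top[of 128]
  proof eventually_elim
    case (elim n)
    have "(\<Sum>k\<in>{2 * L + 4..n}. real (Sym_sum_no_ones k) * fact (n - k) / fact n)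
        \<le> real (card {2 * L + 4..n}) * (128 / real n) ^ (L + 2)"
      using elim by (intro sum_bounded_above tail_term_le) auto
    also have "\<dots> \<le> real n * (128 / real n) ^ (L + 2)"
      by (intro mult_right_mono) auto
    finally have "real n ^ L * (\<Sum>k\<in>{2 * L + 4..n}. real (Sym_sum_no_ones k) * fact (n - k) / fact n)
        \<le> real n ^ L * (real n * (128 / real n) ^ (L + 2))"
      by (intro mult_left_mono) auto
    also have "\<dots> = 128 ^ (L + 2) / real n"
      using elim by (simp add: power_divide field_simps)
    finally show ?case .
  qed
qed

section \<open>Stirling expansion of the reciprocal falling factorial\<close>

text \<open>For the full series, the recurrence \<open>S(l+1,k+1) = (k+1) S(l,k+1) + S(l,k)\<close>
  says that multiplying column \<open>k+1\<close> by \<open>x - (k+1)\<close> gives column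
  \<open>k\<close>. Truncation leaves one boundary term, and the index shift caused by
  \<open>x\<close> lowers the number of terms by one.\<close>

lemma Stirling_partial_sum_rec:
  fixes x :: real
  assumes "x \<noteq> 0"
  shows "(x - real (Suc k)) * (\<Sum>l<Suc M. real (Stirling l (Suc k)) / x ^ Suc l)
    = (\<Sum>l<M. real (Stirling l k) / x ^ Suc l) - real (Suc k) * real (Stirling M (Suc k)) / x ^ Suc M"
proof (induction M)
  case (Suc M)
  have "(x - real (Suc k)) * (\<Sum>l<Suc (Suc M). real (Stirling l (Suc k)) / x ^ Suc l)
    = (\<Sum>l<M. real (Stirling l k) / x ^ Suc l) - real (Suc k) * real (Stirling M (Suc k)) / x ^ Suc M
      + (x - real (Suc k)) * (real (Stirling (Suc M) (Suc k)) / x ^ Suc (Suc M))"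
    using Suc by (simp only: sum.lessThan_Suc[of _ "Suc M"] distrib_left)
  also have "(x - real (Suc k)) * (real (Stirling (Suc M) (Suc k)) / x ^ Suc (Suc M))
    = real (Stirling (Suc M) (Suc k)) / x ^ Suc M
      - real (Suc k) * real (Stirling (Suc M) (Suc k)) / x ^ Suc (Suc M)"
    using assms by (simp add: field_simps)
  also have "real (Stirling (Suc M) (Suc k)) / x ^ Suc M
    = real (Suc k) * real (Stirling M (Suc k)) / x ^ Suc M + real (Stirling M k) / x ^ Suc M"
    by (simp add: add_divide_distrib distrib_right)
  finally show ?case by simp
qed simp

text \<open>This is the generating function of \<open>S(l,k)\<close> at \<open>1/n\<close>,
  truncated. Passing from \<open>k\<close> to \<open>k+1\<close> divides by \<open>n - (k+1)\<close>
  and so gains one power of \<open>n\<close>: order \<open>M\<close> uses the induction hypothesis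
  at \<open>M - 1\<close>, which is why \<open>M\<close> is arbitrary.\<close>

lemma inverse_falling_asymp:
  "(\<lambda>n. real n ^ M * (1 / (\<Prod>j<Suc k. real n - real j)
      - (\<Sum>l<M. real (Stirling l k) / real n ^ Suc l))) \<longlonglongrightarrow> 0"
proof (induction k arbitrary: M)
  case 0
  show ?case
  proof (cases M)
    case 0
    then show ?thesis using lim_const_over_n[of "1::real"] by simp
  next
    case (Suc m)
    \<comment> \<open>Only \<open>Stirling 0 0\<close> is nonzero in column 0, so the difference
      vanishes identically, even at 0, where both sides are 0 by division by zero.\<close>
    have "(\<Sum>l<M. real (Stirling l 0) / x ^ Suc l) = 1 / x" for x :: real
      unfolding Suc sum.lessThan_Suc_shift by simp
    then show ?thesis by simp
  qed
next
  case (Suc k)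
  have inv0: "(\<lambda>n. 1 / (real n - real (Suc k))) \<longlonglongrightarrow> 0"
  proof -
    have "filterlim (\<lambda>n. - real (Suc k) + real n) at_top sequentially"
      by (rule filterlim_tendsto_add_at_top[OF tendsto_const filterlim_real_sequentially])
    then show ?thesis
      by (intro tendsto_divide_0[OF tendsto_const] filterlim_at_top_imp_at_infinity)
        (simp add: algebra_simps)
  qed
  show ?case
  proof (cases M)
    case 0
    \<comment> \<open>No lower order exists here; the hypothesis at order 0 is multiplied by the new
      factor, which tends to 0.\<close>
    have "(\<lambda>n. (real n ^ 0 * (1 / (\<Prod>j<Suc k. real n - real j)
        - (\<Sum>l<0. real (Stirling l k) / real n ^ Suc l))) * (1 / (real n - real (Suc k)))) \<longlonglongrightarrow> 0 * 0"
      by (intro tendsto_mult Suc.IH inv0)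
    then show ?thesis using 0 by simp
  next
    case (Suc m)
    let ?F = "\<lambda>n k. 1 / (\<Prod>j<Suc k. real n - real j)"
    let ?T = "\<lambda>n k M. \<Sum>l<M. real (Stirling l k) / real n ^ Suc l"
    let ?c = "real (Suc k) * real (Stirling m (Suc k))"
    \<comment> \<open>The first factor is \<open>n / (n - (k+1))\<close>, written so that its limit
      1 is visible. One of the \<open>M = m + 1\<close> powers of \<open>n\<close> goes into it; the
      other \<open>m\<close> turn the boundary term into \<open>?c / real n\<close>.\<close>
    have "(\<lambda>n. (1 + real (Suc k) * (1 / (real n - real (Suc k))))
        * (real n ^ m * (?F n k - ?T n k m) + ?c / real n)) \<longlonglongrightarrow> (1 + real (Suc k) * 0) * (0 + 0)"
      by (intro tendsto_intros Suc.IH inv0 lim_const_over_n)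
    moreover have "\<forall>\<^sub>F n in sequentially.
        (1 + real (Suc k) * (1 / (real n - real (Suc k)))) * (real n ^ m * (?F n k - ?T n k m) + ?c / real n)
        = real n ^ M * (?F n (Suc k) - ?T n (Suc k) M)"
      using eventually_gt_at_top[of "Suc k"]
    proof eventually_elim
      case (elim n)
      define y where "y = real n - real (Suc k)"
      have y: "y \<noteq> 0" "real n \<noteq> 0" using elim by (auto simp: y_def)
      have F: "y * ?F n (Suc k) = ?F n k"
        using y by (simp add: y_def)
      have T: "y * ?T n (Suc k) M = ?T n k m - ?c / real n ^ Suc m"
        unfolding y_def Suc using Stirling_partial_sum_rec[of "real n" k m] y by simp
      have "y * (?F n (Suc k) - ?T n (Suc k) M) = ?F n k - ?T n k m + ?c / real n ^ Suc m"
        unfolding right_diff_distrib F T by simp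
      then have D: "?F n (Suc k) - ?T n (Suc k) M = (?F n k - ?T n k m + ?c / real n ^ Suc m) / y"
        using y by (simp add: field_simps)
      have "1 + real (Suc k) * (1 / y) = real n / y"
        using y by (simp add: y_def field_simps)
      moreover have "real n / y * (real n ^ m * w + ?c / real n)
          = real n ^ M * ((w + ?c / real n ^ Suc m) / y)" for w
        unfolding Suc using y by (simp add: field_simps)
      ultimately show ?case unfolding D unfolding y_def by simp
    qed
    ultimately show ?thesis by (auto intro: Lim_transform_eventually)
  qed
qed

section \<open>Head, tail and interchange of the sums over \<open>k\<close> and
  \<open>l\<close>\<close>

theorem mainTheorem3:
  fixes L :: nat
  shows "(\<lambda>n::nat. real n ^ L *
           (real (Z3 n) / fact n - 1 -
            (\<Sum>l=2..L. 1 / real n ^ l *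
               (\<Sum>k=2..l. real (Stirling (l - 1) (k - 1)) *
                  (\<Sum>q\<in>{q \<in> partitions k. q 1 = 0}. real (Sym k q))))))
         \<longlonglongrightarrow> 0"
proof -
  define A where "A = (\<lambda>k. real (Sym_sum_no_ones k))"
  \<comment> \<open>\<open>K\<close> is independent of \<open>n\<close> and separates the finitely
    many \<open>k\<close> that are expanded from the tail \<open>R\<close>. \<open>T n k\<close> is
    the expansion of the reciprocal falling factorial of length \<open>k\<close> through
    \<open>n ^ (-L)\<close>, and \<open>G\<close> is its scaled error.\<close>
  define K where "K = 2 * L + 4"
  define T where "T = (\<lambda>n k. \<Sum>l<L. real (Stirling l (k - 1)) / real n ^ Suc l)"
  define R where "R = (\<lambda>n. \<Sum>k\<in>{K..n}. A k * fact (n - k) / fact n)"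
  define G where "G = (\<lambda>n k. real n ^ L * (1 / (\<Prod>j<k. real n - real j) - T n k))"
  have A_eq: "(\<Sum>q\<in>{q \<in> partitions k. q 1 = 0}. real (Sym k q)) = A k" for k
    by (simp add: A_def Sym_sum_no_ones_def)
  have "G n k = real n ^ L * (1 / (\<Prod>j<Suc (k - 1). real n - real j)
      - (\<Sum>l<L. real (Stirling l (k - 1)) / real n ^ Suc l))" if "k \<ge> 2" for n k
    using that by (simp add: G_def T_def)
  then have G: "(\<lambda>n. G n k) \<longlonglongrightarrow> 0" if "k \<ge> 2" for k
    using that inverse_falling_asymp[of L "k - 1"] by simp
  have "(\<lambda>n. (\<Sum>k=2..<K. A k * G n k) + real n ^ L * R n) \<longlonglongrightarrow> (\<Sum>k=2..<K. A k * 0) + 0"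
    unfolding R_def A_def K_def by (intro tendsto_intros G tail_tendsto_0) auto
  then have lim: "(\<lambda>n. (\<Sum>k=2..<K. A k * G n k) + real n ^ L * R n) \<longlonglongrightarrow> 0" by simp
  have double: "(\<Sum>l=2..L. 1 / real n ^ l * (\<Sum>k=2..l. real (Stirling (l - 1) (k - 1)) * A k))
      = (\<Sum>k=2..<K. A k * T n k)" for n
  proof -
    have "(\<Sum>l=2..L. 1 / real n ^ l * (\<Sum>k=2..l. real (Stirling (l - 1) (k - 1)) * A k))
      = (\<Sum>l=2..L. \<Sum>k=2..<K. A k * (real (Stirling (l - 1) (k - 1)) / real n ^ l))"
    proof (rule sum.cong[OF refl])
      fix l assume l: "l \<in> {2..L}"
      \<comment> \<open>Since \<open>l \<le> L < K\<close> and \<open>S(l-1,k-1) = 0\<close> for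
        \<open>k > l\<close>, the inner range can be made independent of \<open>l\<close>, so that
        the sums may be swapped.\<close>
      have "(\<Sum>k=2..l. real (Stirling (l - 1) (k - 1)) * A k)
          = (\<Sum>k=2..<K. real (Stirling (l - 1) (k - 1)) * A k)"
        using l by (intro sum.mono_neutral_left) (auto simp: K_def)
      then show "1 / real n ^ l * (\<Sum>k=2..l. real (Stirling (l - 1) (k - 1)) * A k)
          = (\<Sum>k=2..<K. A k * (real (Stirling (l - 1) (k - 1)) / real n ^ l))"
        by (simp add: sum_distrib_left mult.commute sum_divide_distrib)
    qed
    also have "\<dots> = (\<Sum>k=2..<K. A k * (\<Sum>l=2..L. real (Stirling (l - 1) (k - 1)) / real n ^ l))"
      by (subst sum.swap) (simp add: sum_distrib_left)
    also have "\<dots> = (\<Sum>k=2..<K. A k * T n k)"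
    proof (rule sum.cong[OF refl])
      fix k assume k: "k \<in> {2..<K}"
      \<comment> \<open>The added term \<open>l = 1\<close> is \<open>S(0,k-1)\<close>, which is 0
        for \<open>k \<ge> 2\<close>; a shift of the index by one then gives
        \<open>T\<close>.\<close>
      have "(\<Sum>l=2..L. real (Stirling (l - 1) (k - 1)) / real n ^ l)
          = (\<Sum>l=1..L. real (Stirling (l - 1) (k - 1)) / real n ^ l)"
      proof (rule sum.mono_neutral_left)
        show "\<forall>i\<in>{1..L} - {2..L}. real (Stirling (i - 1) (k - 1)) / real n ^ i = 0"
        proof
          fix i assume "i \<in> {1..L} - {2..L}"
          then have "i = 1" by auto
          then show "real (Stirling (i - 1) (k - 1)) / real n ^ i = 0" using k by simp
        qed
      qed auto
      also have "\<dots> = T n k"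
        unfolding T_def by (rule sum.reindex_bij_witness[of _ Suc "\<lambda>l. l - 1"]) auto
      finally show "A k * (\<Sum>l=2..L. real (Stirling (l - 1) (k - 1)) / real n ^ l) = A k * T n k"
        by simp
    qed
    finally show ?thesis .
  qed
  have "\<forall>\<^sub>F n in sequentially. (\<Sum>k=2..<K. A k * G n k) + real n ^ L * R n =
      real n ^ L * (real (Z3 n) / fact n - 1 - (\<Sum>k=2..<K. A k * T n k))"
    using eventually_ge_at_top[of K]
  proof eventually_elim
    case (elim n)
    then have n: "n \<ge> 1" "n \<ge> 2" "K \<ge> 2" by (auto simp: K_def)
    have "real (Z3 n) / fact n = (\<Sum>k\<le>n. A k * fact (n - k) / fact n)"
      by (simp add: Z3_eq_sum_fact[OF n(1)] A_def sum_divide_distrib mult.commute)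
    \<comment> \<open>\<open>k = 0\<close> yields the leading 1 and \<open>k = 1\<close> yields 0,
      as the only partition of 1 is a part 1. From \<open>n \<ge> K\<close> the middle block lies
      inside \<open>{..n}\<close>.\<close>
    also have "{..n} = {0, 1} \<union> ({2..<K} \<union> {K..n})" using elim n by auto
    also have "(\<Sum>k\<in>\<dots>. A k * fact (n - k) / fact n)
        = (\<Sum>k\<in>{0, 1}. A k * fact (n - k) / fact n)
          + ((\<Sum>k=2..<K. A k * fact (n - k) / fact n) + R n)"
      unfolding R_def using n by (subst sum.union_disjoint, auto)+
    also have "(\<Sum>k\<in>{0, 1}. A k * fact (n - k) / fact n) = 1"
      by (simp add: A_def Sym_sum_no_ones_0 Sym_sum_no_ones_1)
    also have "(\<Sum>k=2..<K. A k * fact (n - k) / fact n)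
        = (\<Sum>k=2..<K. A k * (1 / (\<Prod>j<k. real n - real j)))"
    proof (rule sum.cong[OF refl])
      fix k assume "k \<in> {2..<K}"
      then have "k \<le> n" using elim by auto
      from fact_ratio_eq[OF this]
      show "A k * fact (n - k) / fact n = A k * (1 / (\<Prod>j<k. real n - real j))"
        by (metis times_divide_eq_right)
    qed
    finally have Z: "real (Z3 n) / fact n - 1 - (\<Sum>k=2..<K. A k * T n k)
        = (\<Sum>k=2..<K. A k * (1 / (\<Prod>j<k. real n - real j) - T n k)) + R n"
      by (simp add: right_diff_distrib sum_subtractf)
    show ?case unfolding Z G_def
      by (simp add: distrib_left sum_distrib_left mult.left_commute)
  qed
  with lim show ?thesis
    unfolding A_eq double by (rule Lim_transform_eventually)
qed

end
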